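(* Let $\gamma>0$, let $\Omega\subset\mathbb{R}^N$ be a bounded smooth domain, and let $f:[0,\infty)\to\mathbb{R}$ be locally Lipschitz continuous and non-decreasing, with $f(s)>0$ for $s>0$ and $f(0)\ge 0$. Let $\nu\in\mathbb{R}^N$ with $|\nu|=1$, let $a(\nu)<\lambda<\lambda_1(\nu)$, and let $\Omega'$ be a sub-domain of $\Omega_\lambda^\nu$. Let $u\in C(\overline{\Omega})\cap C^2(\Omega)$ be a solution to $$-\Delta u=\frac{1}{u^\gamma}+f(u)\ \text{ in }\Omega,\qquad u>0\ \text{ in }\Omega,\qquad u=0\ \text{ on }\partial\Omega ,$$ let $w=u-u_0$, and assume that $$\frac{\partial w}{\partial\nu}\ge 0\quad\text{in }\Omega'.$$ Then either $\frac{\partial w}{\partial \nu}>0$ in $\Omega'$, or $\frac{\partial w}{\partial\nu}=0$ in $\Omega'$.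
   Context: $u_0\in C(\overline\Omega)\cap C^2(\Omega)$ denotes the unique solution of $-\Delta u_0=u_0^{-\gamma}$ in $\Omega$, $u_0>0$ in $\Omega$, $u_0=0$ on $\partial\Omega$. It is known that $w=u-u_0\in H^1_0(\Omega)$, i.e. $u=u_0+w$ with $w\in H_0^1(\Omega)$. Notation: $\Omega_\lambda^\nu=\{x\in\Omega: x\cdot\nu<\lambda\}$; $R_\lambda^\nu(x)=x+2(\lambda-x\cdot\nu)\nu$ is the reflection through the hyperplane $\{x\cdot\nu=\lambda\}$; $(\Omega_\lambda^\nu)'=R_\lambda^\nu(\Omega_\lambda^\nu)$; $a(\nu)=\inf_{x\in\Omega}x\cdot\nu$; $\lambda_1(\nu)=\sup\{\lambda>a(\nu): (\Omega_t^\nu)'\subset\Omega\text{ for all } a(\nu)<t\le\lambda\}$. A sub-domain is a connected open subset. *)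

theory Defs
  imports "HOL-Analysis.Analysis"
begin

definition dir_deriv :: "'a::euclidean_space \<Rightarrow> ('a \<Rightarrow> real) \<Rightarrow> 'a \<Rightarrow> real"
  where "dir_deriv v g x = frechet_derivative g (at x) v"

definition laplacian :: "('a::euclidean_space \<Rightarrow> real) \<Rightarrow> 'a \<Rightarrow> real"
  where "laplacian g x = (\<Sum>b\<in>Basis. dir_deriv b (dir_deriv b g) x)"

text \<open>Only meant for open \<open>S\<close>, where the derivatives at points of \<open>S\<close> depend only on the
  values of \<open>g\<close> on \<open>S\<close>.\<close>

fun C_k_on :: "nat \<Rightarrow> ('a::euclidean_space \<Rightarrow> real) \<Rightarrow> 'a set \<Rightarrow> bool"
  where
    "C_k_on 0 g S \<longleftrightarrow> continuous_on S g"
  | "C_k_on (Suc k) g S \<longleftrightarrow>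
      (\<forall>x\<in>S. g differentiable (at x)) \<and> (\<forall>b\<in>Basis. C_k_on k (dir_deriv b g) S)"

text \<open>Near each boundary point, after a rotation of the axes, the set is the region above the
  graph of a \<open>C\<^sup>\<infinity>\<close> function of the remaining \<open>N - 1\<close> variables. Here \<open>e\<close> is the
  vertical axis and \<open>h\<close> is evaluated only at projections to the hyperplane orthogonal to \<open>e\<close>.\<close>

definition smooth_boundary :: "'a::euclidean_space set \<Rightarrow> bool"
  where "smooth_boundary \<Omega> \<longleftrightarrow>
    (\<forall>p\<in>frontier \<Omega>. \<exists>r>0. \<exists>e h. norm e = 1 \<and> (\<forall>k. C_k_on k h UNIV) \<and>
      \<Omega> \<inter> ball p r = {x \<in> ball p r. x \<bullet> e > h (x - (x \<bullet> e) *\<^sub>R e)})"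

definition bounded_smooth_domain :: "'a::euclidean_space set \<Rightarrow> bool"
  where "bounded_smooth_domain \<Omega> \<longleftrightarrow>
    open \<Omega> \<and> connected \<Omega> \<and> \<Omega> \<noteq> {} \<and> bounded \<Omega> \<and> smooth_boundary \<Omega>"

text \<open>The library notion concerns families of functions; a constant family is used here.\<close>

definition locally_lipschitz_on :: "real set \<Rightarrow> (real \<Rightarrow> real) \<Rightarrow> bool"
  where "locally_lipschitz_on S g \<longleftrightarrow> local_lipschitz (UNIV :: real set) S (\<lambda>_. g)"

text \<open>Positive classical solutions of the Dirichlet problem \<open>- \<Delta> v = F(v)\<close> in \<open>\<Omega>\<close>,
  \<open>v = 0\<close> on the boundary. Values of \<open>v\<close> off the closure of \<open>\<Omega>\<close> are irrelevant.\<close>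

definition positive_dirichlet_solution ::
  "'a::euclidean_space set \<Rightarrow> (real \<Rightarrow> real) \<Rightarrow> ('a \<Rightarrow> real) \<Rightarrow> bool"
  where "positive_dirichlet_solution \<Omega> F v \<longleftrightarrow>
    continuous_on (closure \<Omega>) v \<and> C_k_on 2 v \<Omega> \<and>
    (\<forall>x\<in>\<Omega>. - laplacian v x = F (v x)) \<and>
    (\<forall>x\<in>\<Omega>. v x > 0) \<and> (\<forall>x\<in>frontier \<Omega>. v x = 0)"

definition cap :: "'a::euclidean_space set \<Rightarrow> 'a \<Rightarrow> real \<Rightarrow> 'a set"
  where "cap \<Omega> \<nu> l = {x \<in> \<Omega>. x \<bullet> \<nu> < l}"

definition hyperplane_reflection :: "'a::euclidean_space \<Rightarrow> real \<Rightarrow> 'a \<Rightarrow> 'a"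
  where "hyperplane_reflection \<nu> l x = x + (2 * (l - x \<bullet> \<nu>)) *\<^sub>R \<nu>"

definition reflected_cap :: "'a::euclidean_space set \<Rightarrow> 'a \<Rightarrow> real \<Rightarrow> 'a set"
  where "reflected_cap \<Omega> \<nu> l = hyperplane_reflection \<nu> l ` cap \<Omega> \<nu> l"

definition cap_start :: "'a::euclidean_space set \<Rightarrow> 'a \<Rightarrow> real"
  where "cap_start \<Omega> \<nu> = (INF x\<in>\<Omega>. x \<bullet> \<nu>)"

text \<open>The supremum \<open>\<lambda>\<^sub>1(\<nu>)\<close> is taken in the extended reals, so that no value has to be
  invented for a supremum over an empty or unbounded set; for a bounded smooth domain and a unit
  vector \<open>\<nu>\<close> the set is nonempty and bounded above, and this is the real supremum.\<close>

definition max_cap_position :: "'a::euclidean_space set \<Rightarrow> 'a \<Rightarrow> ereal"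
  where "max_cap_position \<Omega> \<nu> =
    Sup (ereal ` {l. l > cap_start \<Omega> \<nu> \<and>
      (\<forall>t. cap_start \<Omega> \<nu> < t \<and> t \<le> l \<longrightarrow> reflected_cap \<Omega> \<nu> t \<subseteq> \<Omega>)})"

end

theory Submission
  imports Defs
begin

text \<open>
  The function \<open>g = \<partial>w/\<partial>\<nu>\<close> should satisfy a linear differential inequality
  \<open>\<Delta> g \<le> C g\<close> locally in \<open>\<Omega>'\<close>, and the strong maximum principle then gives the dichotomy.
  Formally differentiating the two equations yields
  \[ - \Delta g = f'(u) \partial_\nu u - \gamma u^{-\gamma-1} \partial_\nu u
       + \gamma u_0^{-\gamma-1} \partial_\nu u_0 . \]
  The sign information needed is as follows.

  \<^item> \<open>u\<^sub>0 \<le> u\<close> in \<open>\<Omega>\<close>, by comparison at a negative minimum of \<open>u - u\<^sub>0\<close>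
    (\<open>solution_le_of_nonlinearity_less\<close>).
  \<^item> \<open>\<partial>u\<^sub>0/\<partial>\<nu> \<ge> 0\<close> in the cap. Since \<open>s powr (- \<gamma>)\<close> is strictly decreasing, no continuation
    argument in the position of the hyperplane is required: for each admissible hyperplane
    separately, \<open>u\<^sub>0\<close> is at most its reflection in the cap (\<open>solution_le_reflection\<close>), and letting
    the hyperplane approach the point gives the sign (\<open>solution_monotone_in_cap\<close>).
  \<^item> Hence \<open>\<partial>u/\<partial>\<nu> = g + \<partial>u\<^sub>0/\<partial>\<nu> \<ge> 0\<close> in \<open>\<Omega>'\<close>, so the monotone term
    \<open>f(u)\<close> contributes with the favourable sign, and the singular terms are bounded by
    \<open>\<gamma> u\<^sup>-\<^sup>\<gamma>\<^sup>-\<^sup>1 g\<close>.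

  As \<open>g\<close> is only continuously differentiable and \<open>f\<close> need not be differentiable, the inequality is
  not meaningful pointwise. It is replaced by the following substitute for a weak formulation: the
  difference quotients of \<open>w\<close> in the direction \<open>\<nu>\<close> are twice differentiable, converge to \<open>g\<close> locally
  uniformly, and satisfy the inequality up to a uniformly small error
  (\<open>approx_supersolution_dir_deriv\<close>); the term with \<open>f\<close> is handled by monotonicity alone. Hopf's
  barrier argument goes through for such approximable functions, because a minimum on a ball
  which is strict with respect to the boundary values survives a uniformly small perturbation
  (\<open>no_touching_ball\<close>, \<open>strong_maximum_principle\<close>).
\<close>

section \<open>Second-order calculus in directions\<close>

text \<open>The regularity needed to speak of the Laplacian at one point: differentiability in a
  neighbourhood, and differentiability of the first partial derivatives at the point. Continuity
  of the second derivatives is not required.\<close>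

definition twice_diff_at :: "('a::euclidean_space \<Rightarrow> real) \<Rightarrow> 'a \<Rightarrow> bool"
  where "twice_diff_at g x \<longleftrightarrow>
    (\<forall>\<^sub>F y in nhds x. g differentiable (at y)) \<and>
    (\<forall>b\<in>Basis. dir_deriv b g differentiable (at x))"

lemma dir_deriv_eq: "(g has_derivative G) (at x) \<Longrightarrow> dir_deriv v g x = G v"
  unfolding dir_deriv_def using frechet_derivative_at by metis

lemma dir_deriv_add_dir:
  "g differentiable (at x) \<Longrightarrow> dir_deriv (a + b) g x = dir_deriv a g x + dir_deriv b g x"
  unfolding dir_deriv_def by (simp add: linear_add linear_frechet_derivative)

lemma dir_deriv_scale_dir:
  "g differentiable (at x) \<Longrightarrow> dir_deriv (c *\<^sub>R a) g x = c * dir_deriv a g x"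
  unfolding dir_deriv_def by (simp add: linear_cmul linear_frechet_derivative)

lemma dir_deriv_expand:
  assumes "g differentiable (at x)"
  shows "dir_deriv v g x = (\<Sum>b\<in>Basis. (v \<bullet> b) * dir_deriv b g x)"
proof -
  have lin: "linear (frechet_derivative g (at x))"
    by (rule linear_frechet_derivative[OF assms])
  have "frechet_derivative g (at x) v = frechet_derivative g (at x) (\<Sum>b\<in>Basis. (v \<bullet> b) *\<^sub>R b)"
    by (simp add: euclidean_representation)
  also have "\<dots> = (\<Sum>b\<in>Basis. (v \<bullet> b) * frechet_derivative g (at x) b)"
    by (simp add: linear_sum[OF lin] linear_cmul[OF lin])
  finally show ?thesis
    by (simp add: dir_deriv_def)
qed

lemma differentiable_eventually_eq:
  assumes "f differentiable (at x)" and "\<forall>\<^sub>F y in nhds x. f y = g y"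
  shows "g differentiable (at x)"
proof -
  from assms(2) obtain S where S: "open S" "x \<in> S" "\<And>y. y \<in> S \<Longrightarrow> f y = g y"
    unfolding eventually_nhds by blast
  from assms(1) obtain G where "(f has_derivative G) (at x)"
    unfolding differentiable_def by blast
  then show ?thesis
    using has_derivative_transform_within_open[of f G x UNIV S g] S differentiable_def by blast
qed

lemma dir_deriv_eventually_eq:
  assumes "f differentiable (at x)" and "\<forall>\<^sub>F y in nhds x. f y = g y"
  shows "dir_deriv v f x = dir_deriv v g x"
proof -
  from assms(2) obtain S where "open S" "x \<in> S" "\<forall>y\<in>S. f y = g y"
    unfolding eventually_nhds by blast
  then show ?thesis
    using frechet_derivative_transform_within_open[OF assms(1), of S g]
    by (simp add: dir_deriv_def)
qed

lemma twice_diff_at_eventually: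
  assumes "twice_diff_at g x"
  shows "\<forall>\<^sub>F y in nhds x. g differentiable (at y)"
  using assms by (simp add: twice_diff_at_def)

lemma twice_diff_at_imp_differentiable:
  assumes "twice_diff_at g x"
  shows "g differentiable (at x)"
  using eventually_nhds_x_imp_x[OF twice_diff_at_eventually[OF assms]] .

lemma dir_deriv_differentiable:
  assumes "twice_diff_at g x"
  shows "dir_deriv v g differentiable (at x)"
proof (rule differentiable_eventually_eq)
  show "(\<lambda>y. \<Sum>b\<in>Basis. (v \<bullet> b) * dir_deriv b g y) differentiable (at x)"
    using assms unfolding twice_diff_at_def
    by (intro differentiable_sum ballI) (auto intro!: differentiable_mult)
  show "\<forall>\<^sub>F y in nhds x. (\<Sum>b\<in>Basis. (v \<bullet> b) * dir_deriv b g y) = dir_deriv v g y"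
    using twice_diff_at_eventually[OF assms]
    by eventually_elim (simp add: dir_deriv_expand)
qed

text \<open>The second derivative \<open>dir_deriv a (dir_deriv b g) x\<close> is additive and homogeneous in \<open>a\<close>
  directly; the next two lemmas give the same for \<open>b\<close>.\<close>

lemma second_deriv_add_dir:
  assumes "twice_diff_at g x"
  shows "dir_deriv v (dir_deriv (a + b) g) x
    = dir_deriv v (dir_deriv a g) x + dir_deriv v (dir_deriv b g) x"
proof -
  note d = dir_deriv_differentiable[OF assms]
  have "dir_deriv v (dir_deriv (a + b) g) x = dir_deriv v (\<lambda>y. dir_deriv a g y + dir_deriv b g y) x"
    using twice_diff_at_eventually[OF assms]
    by (intro dir_deriv_eventually_eq d) (auto elim!: eventually_mono simp: dir_deriv_add_dir)
  also have "\<dots> = dir_deriv v (dir_deriv a g) x + dir_deriv v (dir_deriv b g) x"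
    using d[of a] d[of b] unfolding frechet_derivative_works dir_deriv_def[of v]
    by (intro dir_deriv_eq[unfolded dir_deriv_def] has_derivative_add)
  finally show ?thesis .
qed

lemma second_deriv_scale_dir:
  assumes "twice_diff_at g x"
  shows "dir_deriv v (dir_deriv (c *\<^sub>R a) g) x = c * dir_deriv v (dir_deriv a g) x"
proof -
  note d = dir_deriv_differentiable[OF assms]
  have "dir_deriv v (dir_deriv (c *\<^sub>R a) g) x = dir_deriv v (\<lambda>y. c * dir_deriv a g y) x"
    using twice_diff_at_eventually[OF assms]
    by (intro dir_deriv_eventually_eq d) (auto elim!: eventually_mono simp: dir_deriv_scale_dir)
  also have "\<dots> = c * dir_deriv v (dir_deriv a g) x"
    using d[of a] unfolding frechet_derivative_works dir_deriv_def[of v]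
    by (intro dir_deriv_eq[unfolded dir_deriv_def] has_derivative_mult_right)
  finally show ?thesis .
qed

lemma dir_deriv_diff:
  assumes "f differentiable (at x)" "g differentiable (at x)"
  shows "dir_deriv v (\<lambda>y. f y - g y) x = dir_deriv v f x - dir_deriv v g x"
  using assms unfolding frechet_derivative_works dir_deriv_def
  by (intro dir_deriv_eq[unfolded dir_deriv_def] has_derivative_diff)

lemma dir_deriv_cmult:
  assumes "f differentiable (at x)"
  shows "dir_deriv v (\<lambda>y. c * f y) x = c * dir_deriv v f x"
  using assms unfolding frechet_derivative_works dir_deriv_def
  by (intro dir_deriv_eq[unfolded dir_deriv_def] has_derivative_mult_right)

lemma
  assumes f: "twice_diff_at f x" and g: "twice_diff_at g x"
  shows twice_diff_at_diff: "twice_diff_at (\<lambda>y. f y - g y) x"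
    and laplacian_diff: "laplacian (\<lambda>y. f y - g y) x = laplacian f x - laplacian g x"
proof -
  note df = dir_deriv_differentiable[OF f] and dg = dir_deriv_differentiable[OF g]
  have ev: "\<forall>\<^sub>F y in nhds x. f differentiable (at y) \<and> g differentiable (at y)"
    using twice_diff_at_eventually[OF f] twice_diff_at_eventually[OF g]
    by (rule eventually_conj)
  have eq: "\<forall>\<^sub>F y in nhds x. dir_deriv v f y - dir_deriv v g y = dir_deriv v (\<lambda>y. f y - g y) y" for v
    using ev by eventually_elim (simp add: dir_deriv_diff)
  have d: "(\<lambda>y. dir_deriv v f y - dir_deriv v g y) differentiable (at x)" for v
    by (intro differentiable_diff df dg)
  show "twice_diff_at (\<lambda>y. f y - g y) x"
    unfolding twice_diff_at_def
  proof (intro conjI ballI)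
    show "\<forall>\<^sub>F y in nhds x. (\<lambda>y. f y - g y) differentiable (at y)"
      using ev by eventually_elim simp
    show "dir_deriv b (\<lambda>y. f y - g y) differentiable (at x)" for b
      by (rule differentiable_eventually_eq[OF d eq])
  qed
  have "dir_deriv b (dir_deriv b (\<lambda>y. f y - g y)) x
      = dir_deriv b (dir_deriv b f) x - dir_deriv b (dir_deriv b g) x" for b
    by (simp flip: dir_deriv_eventually_eq[OF d eq] add: dir_deriv_diff df dg)
  then show "laplacian (\<lambda>y. f y - g y) x = laplacian f x - laplacian g x"
    by (simp add: laplacian_def sum_subtractf)
qed

lemma
  assumes f: "twice_diff_at f x"
  shows twice_diff_at_cmult: "twice_diff_at (\<lambda>y. c * f y) x"
    and laplacian_cmult: "laplacian (\<lambda>y. c * f y) x = c * laplacian f x"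
proof -
  note df = dir_deriv_differentiable[OF f]
  note ev = twice_diff_at_eventually[OF f]
  have eq: "\<forall>\<^sub>F y in nhds x. c * dir_deriv v f y = dir_deriv v (\<lambda>y. c * f y) y" for v
    using ev by eventually_elim (simp add: dir_deriv_cmult)
  have d: "(\<lambda>y. c * dir_deriv v f y) differentiable (at x)" for v
    by (intro differentiable_mult differentiable_const df)
  show "twice_diff_at (\<lambda>y. c * f y) x"
    unfolding twice_diff_at_def
  proof (intro conjI ballI)
    show "\<forall>\<^sub>F y in nhds x. (\<lambda>y. c * f y) differentiable (at y)"
      using ev by eventually_elim simp
    show "dir_deriv b (\<lambda>y. c * f y) differentiable (at x)" for b
      by (rule differentiable_eventually_eq[OF d eq])
  qed
  have "dir_deriv b (dir_deriv b (\<lambda>y. c * f y)) x = c * dir_deriv b (dir_deriv b f) x" for b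
    by (simp flip: dir_deriv_eventually_eq[OF d eq] add: dir_deriv_cmult df)
  then show "laplacian (\<lambda>y. c * f y) x = c * laplacian f x"
    by (simp add: laplacian_def sum_distrib_left)
qed

lemma
  fixes L :: "'a::euclidean_space \<Rightarrow> 'a"
  assumes T: "\<And>y. (T has_derivative L) (at y)" and f: "f differentiable (at (T x))"
  shows differentiable_compose_affine: "(\<lambda>y. f (T y)) differentiable (at x)"
    and dir_deriv_compose_affine: "dir_deriv v (\<lambda>y. f (T y)) x = dir_deriv (L v) f (T x)"
proof -
  have "((\<lambda>y. f (T y)) has_derivative (\<lambda>v. frechet_derivative f (at (T x)) (L v))) (at x)"
    using has_derivative_compose[OF T f[unfolded frechet_derivative_works]] by (simp add: o_def)
  then show "(\<lambda>y. f (T y)) differentiable (at x)"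
    and "dir_deriv v (\<lambda>y. f (T y)) x = dir_deriv (L v) f (T x)"
    by (auto simp: dir_deriv_eq differentiable_def dir_deriv_def[of "L v"])
qed

lemma
  fixes L :: "'a::euclidean_space \<Rightarrow> 'a"
  assumes T: "\<And>y. (T has_derivative L) (at y)" and f: "twice_diff_at f (T x)"
  shows twice_diff_at_compose_affine: "twice_diff_at (\<lambda>y. f (T y)) x"
    and laplacian_compose_affine:
      "laplacian (\<lambda>y. f (T y)) x = (\<Sum>b\<in>Basis. dir_deriv (L b) (dir_deriv (L b) f) (T x))"
proof -
  have "isCont T x"
    by (rule has_derivative_continuous[OF T])
  then have "(T \<longlongrightarrow> T x) (nhds x)"
    by (simp add: isCont_def tendsto_at_iff_tendsto_nhds)
  then have ev: "\<forall>\<^sub>F y in nhds x. f differentiable (at (T y))"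
    using eventually_compose_filterlim[OF twice_diff_at_eventually[OF f]] by blast
  have eq: "\<forall>\<^sub>F y in nhds x. dir_deriv (L v) f (T y) = dir_deriv v (\<lambda>y. f (T y)) y" for v
    using ev by eventually_elim (simp add: dir_deriv_compose_affine[OF T])
  have d: "(\<lambda>y. dir_deriv (L v) f (T y)) differentiable (at x)" for v
    by (rule differentiable_compose_affine[OF T dir_deriv_differentiable[OF f]])
  show "twice_diff_at (\<lambda>y. f (T y)) x"
    unfolding twice_diff_at_def
  proof (intro conjI ballI)
    show "\<forall>\<^sub>F y in nhds x. (\<lambda>y. f (T y)) differentiable (at y)"
      using ev by eventually_elim (rule differentiable_compose_affine[OF T])
    show "dir_deriv b (\<lambda>y. f (T y)) differentiable (at x)" for b
      by (rule differentiable_eventually_eq[OF d eq])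
  qed
  have "dir_deriv b (dir_deriv b (\<lambda>y. f (T y))) x = dir_deriv (L b) (dir_deriv (L b) f) (T x)" for b
    by (simp flip: dir_deriv_eventually_eq[OF d eq]
        add: dir_deriv_compose_affine[OF T dir_deriv_differentiable[OF f]])
  then show "laplacian (\<lambda>y. f (T y)) x = (\<Sum>b\<in>Basis. dir_deriv (L b) (dir_deriv (L b) f) (T x))"
    by (simp add: laplacian_def)
qed

lemma has_derivative_translation: "((\<lambda>y. y + c) has_derivative (\<lambda>v. v)) (at y)"
  by (auto intro!: derivative_eq_intros)

lemma has_derivative_reflection:
  "(hyperplane_reflection \<nu> l has_derivative (\<lambda>v. v + (- 2 * (v \<bullet> \<nu>)) *\<^sub>R \<nu>)) (at y)"
  unfolding hyperplane_reflection_def[abs_def]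
  by (auto intro!: derivative_eq_intros)

text \<open>Invariance of the trace of the Hessian under the linear part \<open>b \<mapsto> b - 2 (b \<bullet> \<nu>) \<nu>\<close> of the
  reflection: expanding bilinearly, the mixed terms sum to \<open>- 4 H \<nu> \<nu>\<close> and the quadratic term to
  \<open>4 H \<nu> \<nu>\<close>. Symmetry of the Hessian is not needed.\<close>

lemma laplacian_reflection:
  fixes f :: "'a::euclidean_space \<Rightarrow> real"
  assumes \<nu>: "norm \<nu> = 1" and f: "twice_diff_at f (hyperplane_reflection \<nu> l x)"
  shows "laplacian (\<lambda>y. f (hyperplane_reflection \<nu> l y)) x
    = laplacian f (hyperplane_reflection \<nu> l x)"
proof -
  define z where "z = hyperplane_reflection \<nu> l x"
  define H where "H a b = dir_deriv a (dir_deriv b f) z" for a b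
  have f': "twice_diff_at f z"
    using f by (simp add: z_def)
  note d = dir_deriv_differentiable[OF f']
  have add1: "H (a + b) v = H a v + H b v" and scale1: "H (c *\<^sub>R a) v = c * H a v"
    and add2: "H v (a + b) = H v a + H v b" and scale2: "H v (c *\<^sub>R a) = c * H v a" for a b c v
    by (simp_all add: H_def dir_deriv_add_dir dir_deriv_scale_dir d second_deriv_add_dir[OF f']
        second_deriv_scale_dir[OF f'])
  have sum1: "H (\<Sum>b\<in>B. F b) v = (\<Sum>b\<in>B. H (F b) v)" if "finite B" for B v and F :: "'a \<Rightarrow> 'a"
    using that scale1[of 0] by induction (simp_all add: add1)
  have sum2: "H v (\<Sum>b\<in>B. F b) = (\<Sum>b\<in>B. H v (F b))" if "finite B" for B v and F :: "'a \<Rightarrow> 'a"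
    using that scale2[of _ 0] by induction (simp_all add: add2)
  have rep: "(\<Sum>b\<in>Basis. (b \<bullet> \<nu>) *\<^sub>R b) = \<nu>"
    by (metis (no_types, lifting) euclidean_representation inner_commute sum.cong)
  have s1: "(\<Sum>b\<in>Basis. (b \<bullet> \<nu>) * H b \<nu>) = H \<nu> \<nu>"
    using sum1[of Basis "\<lambda>b. (b \<bullet> \<nu>) *\<^sub>R b" \<nu>] by (simp add: rep scale1)
  have s2: "(\<Sum>b\<in>Basis. (b \<bullet> \<nu>) * H \<nu> b) = H \<nu> \<nu>"
    using sum2[of Basis \<nu> "\<lambda>b. (b \<bullet> \<nu>) *\<^sub>R b"] by (simp add: rep scale2)
  have s3: "(\<Sum>b\<in>Basis. (b \<bullet> \<nu>) * (b \<bullet> \<nu>)) = 1"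
    using \<nu> euclidean_inner[of \<nu> \<nu>] by (simp add: inner_commute norm_eq_sqrt_inner)
  have "laplacian (\<lambda>y. f (hyperplane_reflection \<nu> l y)) x
      = (\<Sum>b\<in>Basis. H (b + (- 2 * (b \<bullet> \<nu>)) *\<^sub>R \<nu>) (b + (- 2 * (b \<bullet> \<nu>)) *\<^sub>R \<nu>))"
    unfolding laplacian_compose_affine[OF has_derivative_reflection f] H_def z_def ..
  also have "\<dots> = (\<Sum>b\<in>Basis. H b b - 2 * ((b \<bullet> \<nu>) * H b \<nu>) - 2 * ((b \<bullet> \<nu>) * H \<nu> b)
      + 4 * ((b \<bullet> \<nu>) * (b \<bullet> \<nu>)) * H \<nu> \<nu>)"
    by (intro sum.cong refl) (simp only: add1 add2 scale1 scale2, simp add: algebra_simps)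
  also have "\<dots> = (\<Sum>b\<in>Basis. H b b) - 2 * (\<Sum>b\<in>Basis. (b \<bullet> \<nu>) * H b \<nu>)
      - 2 * (\<Sum>b\<in>Basis. (b \<bullet> \<nu>) * H \<nu> b) + 4 * (\<Sum>b\<in>Basis. (b \<bullet> \<nu>) * (b \<bullet> \<nu>)) * H \<nu> \<nu>"
    by (simp add: sum.distrib sum_subtractf sum_distrib_left sum_distrib_right)
  also have "\<dots> = laplacian f z"
    by (simp add: s1 s2 s3) (simp add: H_def laplacian_def)
  finally show ?thesis
    by (simp add: z_def)
qed

lemma C_2_on_imp_twice_diff_at:
  assumes "C_k_on 2 g S" "open S" "x \<in> S"
  shows "twice_diff_at g x"
proof -
  have "\<forall>x\<in>S. g differentiable (at x)" "\<forall>b\<in>Basis. \<forall>x\<in>S. dir_deriv b g differentiable (at x)"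
    using assms(1) by (simp_all add: numeral_2_eq_2)
  then show ?thesis
    using assms(2,3) by (auto simp: twice_diff_at_def eventually_nhds)
qed

lemma continuous_on_dir_deriv:
  assumes "\<And>x. x \<in> S \<Longrightarrow> twice_diff_at g x"
  shows "continuous_on S (dir_deriv v g)"
  using assms dir_deriv_differentiable differentiable_imp_continuous_within
  by (intro continuous_at_imp_continuous_on) blast

lemma has_real_derivative_line:
  fixes g :: "'a::euclidean_space \<Rightarrow> real"
  assumes "g differentiable (at (x + t *\<^sub>R v))"
  shows "((\<lambda>t. g (x + t *\<^sub>R v)) has_real_derivative dir_deriv v g (x + t *\<^sub>R v)) (at t)"
proof -
  have 1: "((\<lambda>t. x + t *\<^sub>R v) has_derivative (\<lambda>s. s *\<^sub>R v)) (at t)"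
    by (auto intro!: derivative_eq_intros)
  have "((\<lambda>t. g (x + t *\<^sub>R v)) has_derivative
      (\<lambda>s. frechet_derivative g (at (x + t *\<^sub>R v)) (s *\<^sub>R v))) (at t)"
    using has_derivative_compose[OF 1 assms[unfolded frechet_derivative_works]] .
  then show ?thesis
    unfolding has_field_derivative_def dir_deriv_def
    by (simp add: linear_cmul[OF linear_frechet_derivative[OF assms]] mult.commute[of _ "frechet_derivative _ _ _"])
qed

lemma diff_quotient_uniform:
  fixes G :: "'a::euclidean_space \<Rightarrow> real"
  assumes diff: "\<And>x. x \<in> cball p (2 * r) \<Longrightarrow> G differentiable (at x)"
    and cont: "continuous_on (cball p (2 * r)) (dir_deriv \<nu> G)"
    and \<nu>: "norm \<nu> = 1" and r: "r > 0" and \<epsilon>: "\<epsilon> > 0"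
  obtains h0 where "h0 > 0" "\<And>h x. 0 < h \<Longrightarrow> h < h0 \<Longrightarrow> x \<in> cball p r \<Longrightarrow>
    \<bar>(G (x + h *\<^sub>R \<nu>) - G x) / h - dir_deriv \<nu> G x\<bar> \<le> \<epsilon>"
proof -
  have "uniformly_continuous_on (cball p (2 * r)) (dir_deriv \<nu> G)"
    using compact_uniformly_continuous[OF cont] by simp
  then obtain \<delta> where \<delta>: "\<delta> > 0" "\<And>x y. x \<in> cball p (2 * r) \<Longrightarrow> y \<in> cball p (2 * r) \<Longrightarrow>
      dist y x < \<delta> \<Longrightarrow> dist (dir_deriv \<nu> G y) (dir_deriv \<nu> G x) < \<epsilon>"
    using \<epsilon> unfolding uniformly_continuous_on_def by metis
  show ?thesis
  proof (rule that[of "min \<delta> r"])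
    fix h x assume h: "0 < h" "h < min \<delta> r" and x: "x \<in> cball p r"
    have seg: "x + t *\<^sub>R \<nu> \<in> cball p (2 * r)" if "0 \<le> t" "t \<le> h" for t
      using dist_triangle[of p "x + t *\<^sub>R \<nu>" x] x h that \<nu> by (simp add: dist_norm)
    have "((\<lambda>t. G (x + t *\<^sub>R \<nu>)) has_real_derivative dir_deriv \<nu> G (x + t *\<^sub>R \<nu>)) (at t)"
      if "0 \<le> t" "t \<le> h" for t
      using has_real_derivative_line diff seg[OF that] by blast
    then obtain t where t: "0 < t" "t < h"
      "G (x + h *\<^sub>R \<nu>) - G (x + 0 *\<^sub>R \<nu>) = (h - 0) * dir_deriv \<nu> G (x + t *\<^sub>R \<nu>)"
      using MVT2[OF h(1), of "\<lambda>t. G (x + t *\<^sub>R \<nu>)" "\<lambda>t. dir_deriv \<nu> G (x + t *\<^sub>R \<nu>)"] by blast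
    have "dist (dir_deriv \<nu> G (x + t *\<^sub>R \<nu>)) (dir_deriv \<nu> G x) < \<epsilon>"
      using \<delta>(2)[of x "x + t *\<^sub>R \<nu>"] seg[of t] seg[of 0] t(1,2) h \<nu> by (simp add: dist_norm)
    then show "\<bar>(G (x + h *\<^sub>R \<nu>) - G x) / h - dir_deriv \<nu> G x\<bar> \<le> \<epsilon>"
      using t(3) h(1) by (simp add: dist_real_def)
  qed (use \<delta>(1) r in simp)
qed

section \<open>Maximum principles\<close>

lemma laplacian_nonneg_at_local_min:
  fixes g :: "'a::euclidean_space \<Rightarrow> real"
  assumes g: "twice_diff_at g x" and min: "\<forall>\<^sub>F y in nhds x. g x \<le> g y"
  shows "0 \<le> laplacian g x"
  unfolding laplacian_def
proof (rule sum_nonneg)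
  fix b :: 'a assume b: "b \<in> Basis"
  have "\<forall>\<^sub>F y in nhds x. g differentiable (at y) \<and> g x \<le> g y"
    using twice_diff_at_eventually[OF g] min by (rule eventually_conj)
  then obtain r where r: "r > 0" and
    near: "\<And>y. dist y x < r \<Longrightarrow> g differentiable (at y) \<and> g x \<le> g y"
    unfolding eventually_nhds_metric by blast
  have dist: "dist (x + t *\<^sub>R b) x = \<bar>t\<bar>" for t
    using b by (simp add: dist_norm)
  define \<phi> where "\<phi> t = g (x + t *\<^sub>R b)" for t
  define \<phi>' where "\<phi>' t = dir_deriv b g (x + t *\<^sub>R b)" for t
  have d1: "(\<phi> has_real_derivative \<phi>' t) (at t)" if "\<bar>t\<bar> < r" for t
    unfolding \<phi>_def \<phi>'_def using near[of "x + t *\<^sub>R b"] that dist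
    by (intro has_real_derivative_line) auto
  have d2: "(\<phi>' has_real_derivative dir_deriv b (dir_deriv b g) x) (at 0)"
    unfolding \<phi>'_def
    using has_real_derivative_line[of "dir_deriv b g" x 0 b] dir_deriv_differentiable[OF g] by simp
  have min0: "\<phi> 0 \<le> \<phi> t" if "\<bar>t\<bar> < r" for t
    using near[of "x + t *\<^sub>R b"] that dist by (simp add: \<phi>_def)
  have "\<phi>' 0 = 0"
    using DERIV_local_min[OF d1[of 0], of r] r min0 by auto
  show "0 \<le> dir_deriv b (dir_deriv b g) x"
  proof (rule ccontr)
    assume "\<not> ?thesis"
    then obtain d where d: "d > 0" "\<And>h. 0 < h \<Longrightarrow> h < d \<Longrightarrow> \<phi>' h < \<phi>' 0"
      using DERIV_neg_dec_right[OF d2] by force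
    define t where "t = min d r / 2"
    have t: "0 < t" "t < d" "t < r"
      using d(1) r by (auto simp: t_def)
    obtain z where z: "0 < z" "z < t" "\<phi> t - \<phi> 0 = (t - 0) * \<phi>' z"
      using MVT2[of 0 t \<phi> \<phi>'] d1 t by auto
    have "\<phi>' z < 0"
      using d(2)[of z] z t \<open>\<phi>' 0 = 0\<close> by simp
    then show False
      using z(3) t min0[of t] by (smt (verit) mult_pos_neg)
  qed
qed

text \<open>A weak maximum principle in nonlinear form: the differential inequality is only required where
  \<open>d\<close> is negative, which is where monotone nonlinearities give a sign.\<close>

lemma comparison_principle:
  fixes d :: "'a::euclidean_space \<Rightarrow> real"
  assumes U: "open U" "bounded U" and cont: "continuous_on (closure U) d"
    and bd: "\<And>x. x \<in> frontier U \<Longrightarrow> 0 \<le> d x"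
    and diff: "\<And>x. x \<in> U \<Longrightarrow> twice_diff_at d x"
    and neg: "\<And>x. x \<in> U \<Longrightarrow> d x < 0 \<Longrightarrow> laplacian d x < 0"
    and x: "x \<in> U"
  shows "0 \<le> d x"
proof (rule ccontr)
  assume "\<not> ?thesis"
  have "compact (closure U)" "closure U \<noteq> {}"
    using U x closure_subset by (auto simp: compact_closure)
  then obtain z where z: "z \<in> closure U" "\<And>y. y \<in> closure U \<Longrightarrow> d z \<le> d y"
    using continuous_attains_inf cont by meson
  have "d z < 0"
    using z(2)[of x] x closure_subset[of U] \<open>\<not> 0 \<le> d x\<close> by force
  then have "z \<in> U"
    using bd[of z] z(1) interior_open[OF U(1)] unfolding frontier_def by force
  moreover have "\<forall>\<^sub>F y in nhds z. d z \<le> d y"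
    using \<open>z \<in> U\<close> U z(2) closure_subset unfolding eventually_nhds by blast
  ultimately show False
    using laplacian_nonneg_at_local_min[OF diff] neg[of z] \<open>d z < 0\<close> by force
qed

lemma
  fixes y :: "'a::euclidean_space"
  shows twice_diff_at_gaussian: "twice_diff_at (\<lambda>x. exp (- a * ((x - y) \<bullet> (x - y))) - c) x"
    and laplacian_gaussian: "laplacian (\<lambda>x. exp (- a * ((x - y) \<bullet> (x - y))) - c) x
      = (4 * a\<^sup>2 * ((x - y) \<bullet> (x - y)) - 2 * a * DIM('a)) * exp (- a * ((x - y) \<bullet> (x - y)))"
proof -
  define E where "E x = exp (- a * ((x - y) \<bullet> (x - y)))" for x
  have dE: "(E has_derivative (\<lambda>v. - 2 * a * ((x - y) \<bullet> v) * E x)) (at x)" for x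
    unfolding E_def by (auto intro!: derivative_eq_intros simp: inner_commute algebra_simps)
  have d1: "((\<lambda>x. E x - c) has_derivative (\<lambda>v. - 2 * a * ((x - y) \<bullet> v) * E x)) (at x)" for x
    using has_derivative_diff[OF dE has_derivative_const] by simp
  have D: "dir_deriv b (\<lambda>x. E x - c) = (\<lambda>x. - 2 * a * ((x - y) \<bullet> b) * E x)" for b
    using dir_deriv_eq[OF d1] by blast
  have d2: "((\<lambda>x. - 2 * a * ((x - y) \<bullet> b) * E x) has_derivative
      (\<lambda>v. - 2 * a * ((x - y) \<bullet> b) * (- 2 * a * ((x - y) \<bullet> v) * E x) + - 2 * a * (v \<bullet> b) * E x)) (at x)"
    for b x
    by (auto intro!: derivative_eq_intros dE)
  have "twice_diff_at (\<lambda>x. E x - c) x"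
    unfolding twice_diff_at_def D using d1 d2 by (auto simp: differentiable_def intro!: always_eventually)
  then show "twice_diff_at (\<lambda>x. exp (- a * ((x - y) \<bullet> (x - y))) - c) x"
    by (simp add: E_def)
  have "laplacian (\<lambda>x. E x - c) x
      = (\<Sum>b\<in>Basis. 4 * a\<^sup>2 * (((x - y) \<bullet> b) * ((x - y) \<bullet> b)) * E x - 2 * a * E x)"
    unfolding laplacian_def D dir_deriv_eq[OF d2]
    by (intro sum.cong refl) (simp add: power2_eq_square algebra_simps)
  also have "\<dots> = 4 * a\<^sup>2 * (\<Sum>b\<in>Basis. ((x - y) \<bullet> b) * ((x - y) \<bullet> b)) * E x - 2 * a * DIM('a) * E x"
    by (simp add: sum_subtractf sum_distrib_left sum_distrib_right)
  also have "\<dots> = (4 * a\<^sup>2 * ((x - y) \<bullet> (x - y)) - 2 * a * DIM('a)) * E x"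
    by (simp only: euclidean_inner[of "x - y" "x - y", symmetric] left_diff_distrib)
  finally show "laplacian (\<lambda>x. exp (- a * ((x - y) \<bullet> (x - y))) - c) x
      = (4 * a\<^sup>2 * ((x - y) \<bullet> (x - y)) - 2 * a * DIM('a)) * exp (- a * ((x - y) \<bullet> (x - y)))"
    by (simp add: E_def)
qed

lemma positive_lower_bound_on_compact:
  fixes f :: "'a::topological_space \<Rightarrow> real"
  assumes "compact K" "continuous_on K f" "\<And>x. x \<in> K \<Longrightarrow> 0 < f x"
  shows "\<exists>m>0. \<forall>x\<in>K. m \<le> f x"
proof (cases "K = {}")
  case True
  then show ?thesis
    by (auto intro: exI[of _ 1])
next
  case False
  then obtain z where "z \<in> K" "\<And>x. x \<in> K \<Longrightarrow> f z \<le> f x"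
    using continuous_attains_inf[OF assms(1)] assms(2) by meson
  then show ?thesis
    using assms(3) by blast
qed

text \<open>A substitute for the weak inequality \<open>\<Delta> g \<le> C g\<close> on \<open>K\<close> when \<open>g\<close> is not twice
  differentiable: \<open>g\<close> is a uniform limit on \<open>K\<close> of twice differentiable functions that satisfy the
  inequality with an error tending to zero uniformly.\<close>

definition approx_supersolution ::
  "('a::euclidean_space \<Rightarrow> real) \<Rightarrow> real \<Rightarrow> 'a set \<Rightarrow> bool"
  where "approx_supersolution g C K \<longleftrightarrow>
    (\<forall>\<epsilon>>0. \<exists>W. \<forall>x\<in>K. twice_diff_at W x \<and> \<bar>W x - g x\<bar> \<le> \<epsilon> \<and> laplacian W x \<le> C * g x + \<epsilon>)"

lemma approx_supersolution_subset:
  "approx_supersolution g C K \<Longrightarrow> K' \<subseteq> K \<Longrightarrow> approx_supersolution g C K'"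
  unfolding approx_supersolution_def by (meson subsetD)

text \<open>Hopf's boundary argument in contradiction form. The barrier \<open>\<psi>\<close> is positive inside the ball of
  radius \<open>R\<close> about \<open>y\<close>, zero on its sphere and negative outside, and satisfies \<open>\<Delta> \<psi> > C \<psi>\<close> near
  \<open>p\<close>. For small \<open>s\<close> the function \<open>g - s \<psi>\<close> is positive on the sphere of radius \<open>r\<close> about \<open>p\<close> but
  vanishes at \<open>p\<close>; a close approximant \<open>W\<close> of \<open>g\<close> then gives an interior minimum of
  \<open>W - s \<psi>\<close> at which the Laplacian is negative. Comparing on a full ball about \<open>p\<close> makes the
  gradient of \<open>g\<close> at \<open>p\<close> irrelevant.\<close>

lemma no_touching_ball:
  fixes g :: "'a::euclidean_space \<Rightarrow> real"
  assumes p: "g p = 0" "dist p y = R" and R: "R > 0"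
    and r: "0 < r" "r \<le> R / 2"
    and cont: "continuous_on (cball p r) g"
    and nonneg: "\<And>x. x \<in> cball p r \<Longrightarrow> 0 \<le> g x"
    and pos: "\<And>x. x \<in> cball y R \<Longrightarrow> x \<in> cball p r \<Longrightarrow> x \<noteq> p \<Longrightarrow> 0 < g x"
    and C: "0 \<le> C" and sup: "approx_supersolution g C (cball p r)"
  shows False
proof -
  \<comment> \<open>Chosen so that \<open>4 a\<^sup>2 (R / 2)\<^sup>2 - 2 a DIM('a) > C\<close>; points of the small ball have distance
    at least \<open>R / 2\<close> from \<open>y\<close>.\<close>
  define a where "a = 1 + (2 * DIM('a) + C) / R\<^sup>2"
  define E where "E x = exp (- a * ((x - y) \<bullet> (x - y)))" for x
  define \<psi> where "\<psi> x = E x - exp (- a * R\<^sup>2)" for x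
  have sq: "(x - y) \<bullet> (x - y) = (dist x y)\<^sup>2" for x
    by (simp add: dist_norm power2_norm_eq_inner)
  have a: "a \<ge> 1" "a * R\<^sup>2 = R\<^sup>2 + 2 * DIM('a) + C"
    using R C by (simp_all add: a_def field_simps)
  have contE: "continuous_on A E" for A
    unfolding E_def by (intro continuous_intros)
  have cont\<psi>: "continuous_on A \<psi>" for A
    unfolding \<psi>_def by (intro continuous_intros contE)
  have \<psi>_le: "\<psi> x \<le> 1" for x
  proof -
    have "E x \<le> 1" unfolding E_def sq using a(1) by simp
    then show ?thesis unfolding \<psi>_def by (smt (verit) exp_gt_zero)
  qed
  have \<psi>p: "\<psi> p = 0"
    using p(2) unfolding \<psi>_def E_def sq by simp
  have \<psi>_neg: "\<psi> x < 0" if "x \<notin> cball y R" for x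
  proof -
    have "R\<^sup>2 < (dist x y)\<^sup>2"
      using that R by (intro power_strict_mono) (auto simp: dist_commute)
    then show ?thesis
      unfolding \<psi>_def E_def sq using a(1) by simp
  qed
  have td\<psi>: "twice_diff_at \<psi> x" for x
    unfolding \<psi>_def[abs_def] E_def by (rule twice_diff_at_gaussian)
  have lap\<psi>: "0 < laplacian \<psi> x - C * \<psi> x" if x: "x \<in> cball p r" for x
  proof -
    have "R / 2 \<le> dist x y"
      using x r p(2) dist_triangle[of p y x] by (simp add: dist_commute)
    then have "(R / 2)\<^sup>2 \<le> (dist x y)\<^sup>2"
      using R by (intro power_mono) auto
    then have "a * (a * R\<^sup>2) \<le> 4 * a\<^sup>2 * (dist x y)\<^sup>2"
      using a(1) by (simp add: power2_eq_square field_simps)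
    moreover have "a * (a * R\<^sup>2) = a * R\<^sup>2 + 2 * a * DIM('a) + a * C"
      using arg_cong[OF a(2), of "\<lambda>t. a * t"] a(2) by (simp only: distrib_left mult.assoc mult.left_commute)
    moreover have "a * R\<^sup>2 > 0" "a * C \<ge> C"
      using a(1) R C by (auto simp: mult_right_le_one_le mult_le_cancel_right1)
    ultimately have "C < 4 * a\<^sup>2 * (dist x y)\<^sup>2 - 2 * a * DIM('a)"
      by linarith
    then have "C * E x < (4 * a\<^sup>2 * (dist x y)\<^sup>2 - 2 * a * DIM('a)) * E x"
      by (simp add: E_def)
    moreover have "C * \<psi> x \<le> C * E x"
      using C by (intro mult_left_mono) (auto simp: \<psi>_def)
    moreover have "laplacian \<psi> x = (4 * a\<^sup>2 * (dist x y)\<^sup>2 - 2 * a * DIM('a)) * E x"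
      unfolding \<psi>_def[abs_def] E_def by (subst laplacian_gaussian) (simp only: sq)
    ultimately show ?thesis
      by linarith
  qed
  have contlap: "continuous_on (cball p r) (\<lambda>x. laplacian \<psi> x - C * \<psi> x)"
    unfolding \<psi>_def[abs_def] E_def laplacian_gaussian by (intro continuous_intros)
  obtain \<delta> where \<delta>: "\<delta> > 0" "\<And>x. x \<in> cball p r \<Longrightarrow> \<delta> \<le> laplacian \<psi> x - C * \<psi> x"
    using positive_lower_bound_on_compact[OF compact_cball contlap lap\<psi>] by blast
  have sph: "x \<in> cball p r" "x \<noteq> p" if "x \<in> sphere p r" for x
    using that r by auto
  have posK: "0 < g x" if "x \<in> sphere p r \<inter> cball y R" for x
    using pos sph that by blast
  have contK: "continuous_on (sphere p r \<inter> cball y R) g"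
    using cont by (rule continuous_on_subset) auto
  obtain \<eta> where \<eta>: "\<eta> > 0" "\<And>x. x \<in> sphere p r \<inter> cball y R \<Longrightarrow> \<eta> \<le> g x"
    using positive_lower_bound_on_compact[OF compact_Int_closed[OF compact_sphere closed_cball] contK posK]
    by blast
  define s where "s = \<eta> / 2"
  have s: "s > 0"
    using \<eta> by (simp add: s_def)
  have sphpos: "0 < g x - s * \<psi> x" if x: "x \<in> sphere p r" for x
  proof (cases "x \<in> cball y R")
    case True
    have "s * \<psi> x \<le> s"
      using s \<psi>_le[of x] by simp
    moreover have "\<eta> \<le> g x"
      using \<eta>(2) True x by blast
    ultimately show ?thesis
      using s unfolding s_def by linarith
  next
    case False
    then show ?thesis
      using \<psi>_neg[OF False] s nonneg[OF sph(1)[OF x]] by (smt (verit) mult_pos_neg)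
  qed
  have sphcont: "continuous_on (sphere p r) (\<lambda>x. g x - s * \<psi> x)"
    by (intro continuous_intros cont\<psi> continuous_on_subset[OF cont]) auto
  obtain \<mu> where \<mu>: "\<mu> > 0" "\<And>x. x \<in> sphere p r \<Longrightarrow> \<mu> \<le> g x - s * \<psi> x"
    using positive_lower_bound_on_compact[OF compact_sphere sphcont sphpos] by blast
  \<comment> \<open>The first bound keeps the minimum of \<open>W - s \<psi>\<close> off the sphere, the second makes the error
    terms at the minimum smaller than the gain \<open>s \<delta>\<close>.\<close>
  define \<epsilon> where "\<epsilon> = min (\<mu> / 4) (s * \<delta> / (4 * C + 4))"
  have \<epsilon>: "\<epsilon> > 0" "\<epsilon> \<le> \<mu> / 4" "\<epsilon> * (4 * C + 4) \<le> s * \<delta>"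
  proof -
    show "\<epsilon> > 0"
      using \<mu>(1) s \<delta>(1) C by (simp add: \<epsilon>_def)
    show "\<epsilon> \<le> \<mu> / 4"
      unfolding \<epsilon>_def by (rule min.cobounded1)
    have "\<epsilon> \<le> s * \<delta> / (4 * C + 4)"
      by (simp add: \<epsilon>_def)
    then show "\<epsilon> * (4 * C + 4) \<le> s * \<delta>"
      using C by (simp add: pos_le_divide_eq)
  qed
  obtain W where W: "\<And>x. x \<in> cball p r \<Longrightarrow> twice_diff_at W x"
    "\<And>x. x \<in> cball p r \<Longrightarrow> \<bar>W x - g x\<bar> \<le> \<epsilon>"
    "\<And>x. x \<in> cball p r \<Longrightarrow> laplacian W x \<le> C * g x + \<epsilon>"
    using sup \<epsilon>(1) unfolding approx_supersolution_def by metis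
  define D where "D x = W x - s * \<psi> x" for x
  have tdD: "twice_diff_at D x" and lapD: "laplacian D x = laplacian W x - s * laplacian \<psi> x"
    if "x \<in> cball p r" for x
    unfolding D_def[abs_def] using that
    by (simp_all add: twice_diff_at_diff laplacian_diff laplacian_cmult W(1) twice_diff_at_cmult td\<psi>)
  have "continuous_on (cball p r) D"
    using tdD twice_diff_at_imp_differentiable differentiable_imp_continuous_within
    by (intro continuous_at_imp_continuous_on) blast
  moreover have "p \<in> cball p r"
    using r by simp
  ultimately obtain z where z: "z \<in> cball p r" "\<And>x. x \<in> cball p r \<Longrightarrow> D z \<le> D x"
    using continuous_attains_inf[OF compact_cball, of p r D] by blast
  have Dz: "D z \<le> \<epsilon>"
    using z(2)[OF \<open>p \<in> cball p r\<close>] W(2)[OF \<open>p \<in> cball p r\<close>] p(1) \<psi>p by (simp add: D_def)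
  have "z \<notin> sphere p r"
    using \<mu>(2)[of z] W(2)[OF z(1)] Dz \<epsilon>(1,2) \<mu>(1) unfolding D_def by linarith
  then have "z \<in> ball p r"
    using z(1) by auto
  then have "\<forall>\<^sub>F x in nhds z. D z \<le> D x"
    using z(2) ball_subset_cball unfolding eventually_nhds by (metis open_ball subsetD)
  then have "0 \<le> laplacian D z"
    by (rule laplacian_nonneg_at_local_min[OF tdD[OF z(1)]])
  then have "s * laplacian \<psi> z \<le> C * g z + \<epsilon>"
    using W(3)[OF z(1)] lapD[OF z(1)] by simp
  moreover have "s * (\<delta> + C * \<psi> z) \<le> s * laplacian \<psi> z"
    using \<delta>(2)[OF z(1)] s by (intro mult_left_mono) auto
  moreover have "C * (g z - s * \<psi> z) \<le> C * (2 * \<epsilon>)"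
    using Dz W(2)[OF z(1)] C unfolding D_def by (intro mult_left_mono) auto
  ultimately have "s * \<delta> \<le> C * (2 * \<epsilon>) + \<epsilon>"
    by (simp add: algebra_simps)
  moreover have "C * \<epsilon> \<ge> 0"
    using C \<epsilon>(1) by simp
  ultimately show False
    using \<epsilon>(1,3) by (simp add: algebra_simps)
qed

text \<open>A nonempty proper relatively closed subset of a connected open set is touched at exactly
  one point by a closed ball contained in the open set. A ball about a nearby point outside the
  closed set, reaching to a nearest point \<open>p\<close> of it, is halved towards \<open>p\<close> to make the contact
  point unique.\<close>

lemma touching_ball_exists:
  fixes Z :: "'a::euclidean_space set"
  assumes S: "open S" "connected S" and Z: "closedin (top_of_set S) Z" "Z \<noteq> {}" "Z \<noteq> S"
  obtains p y R where "R > 0" "p \<in> Z" "dist p y = R" "cball y R \<subseteq> S" "cball y R \<inter> Z = {p}"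
proof -
  have "Z \<subseteq> S"
    using Z(1) closedin_subset by fastforce
  have "\<not> open Z"
    using S(2) Z \<open>Z \<subseteq> S\<close> open_subset unfolding connected_clopen by blast
  then obtain z where z: "z \<in> Z" "\<And>e. e > 0 \<Longrightarrow> \<not> ball z e \<subseteq> Z"
    unfolding open_contains_ball by blast
  obtain r where r: "r > 0" "cball z r \<subseteq> S"
    using S(1) z(1) \<open>Z \<subseteq> S\<close> open_contains_cball by blast
  obtain y0 where y0: "y0 \<in> ball z (r / 2)" "y0 \<notin> Z"
    using z(2)[of "r / 2"] r(1) by (meson half_gt_zero subsetI)
  have "compact (cball z r \<inter> Z)"
  proof -
    obtain T where "closed T" "Z = S \<inter> T"
      using Z(1) closedin_closed by metis
    then have "cball z r \<inter> Z = cball z r \<inter> T"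
      using r(2) by blast
    then show ?thesis
      using \<open>closed T\<close> by (simp add: compact_Int_closed)
  qed
  then obtain p where p: "p \<in> cball z r \<inter> Z" "\<And>q. q \<in> cball z r \<inter> Z \<Longrightarrow> dist y0 p \<le> dist y0 q"
  proof -
    have "z \<in> cball z r \<inter> Z"
      using z(1) r(1) by simp
    then have "cball z r \<inter> Z \<noteq> {}"
      by blast
    with \<open>compact (cball z r \<inter> Z)\<close> show ?thesis
      using distance_attains_inf[of "cball z r \<inter> Z" y0] that compact_imp_closed by blast
  qed
  define R where "R = dist y0 p / 2"
  have R: "R > 0"
    using p(1) y0(2) by (auto simp: R_def)
  have "2 * R < r / 2"
    using p(2)[of z] z(1) r(1) y0(1) by (simp add: R_def dist_commute)
  define y where "y = midpoint y0 p"
  have yp: "dist p y = R" and y0y: "dist y0 y = R"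
    by (simp_all add: y_def R_def dist_midpoint dist_commute)
  have sub: "cball y R \<subseteq> cball z r"
  proof
    fix x assume "x \<in> cball y R"
    then have "dist z x \<le> dist z y0 + dist y0 y + dist y x" "dist y x \<le> R"
      using dist_triangle[of z x y0] dist_triangle[of y0 x y] by auto
    then show "x \<in> cball z r"
      using y0(1) y0y \<open>2 * R < r / 2\<close> by simp
  qed
  have "x = p" if x: "x \<in> cball y R" "x \<in> Z" for x
  proof (rule ccontr)
    assume "x \<noteq> p"
    have far: "2 * R \<le> dist y0 x"
      using p(2)[of x] x sub by (auto simp: R_def)
    have "dist y0 x \<le> 2 * R" "dist y x \<le> R"
      using dist_triangle[of y0 x y] x(1) y0y by auto
    then have eq: "dist y0 x = dist y0 y + dist y x"
      using far y0y dist_triangle[of y0 x y] by simp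
    have "dist y x = R"
      using eq far y0y \<open>dist y x \<le> R\<close> by simp
    \<comment> \<open>Equality in the triangle inequality forces \<open>x\<close> onto the ray from \<open>y0\<close> through \<open>y\<close>.\<close>
    have "norm (y0 - y) *\<^sub>R (y - x) = norm (y - x) *\<^sub>R (y0 - y)"
      using eq dist_triangle_eq[of y0 x y] by (simp add: dist_norm)
    then have "y - x = y0 - y"
      using y0y \<open>dist y x = R\<close> R by (simp add: dist_norm)
    then have "x = 2 *\<^sub>R y - y0"
      by (simp add: scaleR_2 algebra_simps)
    also have "\<dots> = p"
      by (simp add: y_def midpoint_def)
    finally have "x = p" .
    then show False
      using \<open>x \<noteq> p\<close> by simp
  qed
  then have "cball y R \<inter> Z = {p}"
    using p(1) yp by (auto simp: dist_commute)
  then show ?thesis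
    using that[OF R _ yp] p(1) sub r(2) by blast
qed

lemma strong_maximum_principle:
  fixes g :: "'a::euclidean_space \<Rightarrow> real"
  assumes S: "open S" "connected S" and cont: "continuous_on S g"
    and nonneg: "\<And>x. x \<in> S \<Longrightarrow> 0 \<le> g x"
    and sup: "\<And>p. p \<in> S \<Longrightarrow> \<exists>r>0. \<exists>C\<ge>0. approx_supersolution g C (cball p r)"
  shows "(\<forall>x\<in>S. 0 < g x) \<or> (\<forall>x\<in>S. g x = 0)"
proof (rule ccontr)
  assume neg: "\<not> ?thesis"
  define Z where "Z = {x \<in> S. g x = 0}"
  have "Z \<noteq> {}" "Z \<noteq> S"
    using neg nonneg unfolding Z_def by force+
  moreover have "closedin (top_of_set S) Z"
    unfolding Z_def using continuous_closedin_preimage_constant[OF cont] .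
  ultimately obtain p y R where R: "R > 0" and p: "p \<in> Z" "dist p y = R"
    and ball: "cball y R \<subseteq> S" "cball y R \<inter> Z = {p}"
    using touching_ball_exists[OF S] by metis
  have "p \<in> S"
    using p by (simp add: Z_def)
  then obtain r1 where r1: "r1 > 0" "cball p r1 \<subseteq> S"
    using S(1) open_contains_cball by blast
  obtain r2 C where r2: "r2 > 0" "C \<ge> 0" "approx_supersolution g C (cball p r2)"
    using sup[OF \<open>p \<in> S\<close>] by blast
  define r where "r = min (R / 2) (min r1 r2)"
  have r: "r > 0" "r \<le> R / 2" "cball p r \<subseteq> S" "cball p r \<subseteq> cball p r2"
    using R r1 r2(1) by (auto simp: r_def)
  show False
  proof (rule no_touching_ball[OF _ p(2) R r(1,2)])
    show "g p = 0"
      using p by (simp add: Z_def)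
    show "continuous_on (cball p r) g"
      using cont r(3) continuous_on_subset by blast
    show "0 \<le> g x" if "x \<in> cball p r" for x
      using nonneg that r(3) by blast
    show "0 < g x" if "x \<in> cball y R" "x \<noteq> p" for x
      using nonneg[of x] that ball unfolding Z_def by force
    show "approx_supersolution g C (cball p r)"
      using approx_supersolution_subset r2(3) r(4) by blast
  qed (rule r2(2))
qed

section \<open>Comparison of positive solutions\<close>

lemma positive_dirichlet_solution_nonneg:
  assumes "positive_dirichlet_solution \<Omega> F v" "x \<in> closure \<Omega>"
  shows "0 \<le> v x"
  using assms closure_Un_frontier[of \<Omega>] unfolding positive_dirichlet_solution_def
  by (metis Un_iff less_eq_real_def)

lemma solution_twice_diff_at:
  assumes "positive_dirichlet_solution \<Omega> F v" "open \<Omega>" "x \<in> \<Omega>"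
  shows "twice_diff_at v x"
  using assms C_2_on_imp_twice_diff_at unfolding positive_dirichlet_solution_def by blast

lemma solution_laplacian:
  assumes "positive_dirichlet_solution \<Omega> F v" "x \<in> \<Omega>"
  shows "laplacian v x = - F (v x)"
  using assms unfolding positive_dirichlet_solution_def by force

text \<open>Comparison of a solution with its reflection in the cap. On the flat part of the boundary of the
  cap both agree; on the remaining part the solution vanishes and its reflection is nonnegative.\<close>

lemma solution_le_reflection:
  fixes \<Omega> :: "'a::euclidean_space set"
  assumes \<Omega>: "open \<Omega>" "bounded \<Omega>" and \<nu>: "norm \<nu> = 1"
    and v: "positive_dirichlet_solution \<Omega> F v"
    and F: "\<And>s t. 0 < s \<Longrightarrow> s < t \<Longrightarrow> F t < F s"
    and refl: "reflected_cap \<Omega> \<nu> t \<subseteq> \<Omega>" and x: "x \<in> cap \<Omega> \<nu> t"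
  shows "v x \<le> v (hyperplane_reflection \<nu> t x)"
proof -
  let ?R = "hyperplane_reflection \<nu> t"
  let ?U = "cap \<Omega> \<nu> t"
  have openU: "open ?U"
  proof -
    have "?U = \<Omega> \<inter> {x. x \<bullet> \<nu> < t}" by (auto simp: cap_def)
    then show ?thesis
      using \<Omega>(1) open_halfspace_lt[of \<nu> t] by (auto simp: inner_commute)
  qed
  have UsubO: "?U \<subseteq> \<Omega>" by (auto simp: cap_def)
  have RU: "?R y \<in> \<Omega>" if "y \<in> ?U" for y
    using refl that unfolding reflected_cap_def by blast
  have contR: "continuous_on A ?R" for A
    unfolding hyperplane_reflection_def[abs_def] by (intro continuous_intros)
  have RclU: "?R ` closure ?U \<subseteq> closure \<Omega>"
    by (rule image_closure_subset[OF contR closed_closure]) (use RU closure_subset in blast)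
  have clU: "closure ?U \<subseteq> closure \<Omega>"
    by (rule closure_mono[OF UsubO])
  have cont: "continuous_on (closure \<Omega>) v"
    using v by (simp add: positive_dirichlet_solution_def)
  have "0 \<le> v (?R x) - v x"
  proof (rule comparison_principle[OF openU _ _ _ _ _ x])
    show "bounded ?U"
      using \<Omega>(2) UsubO bounded_subset by blast
    show "continuous_on (closure ?U) (\<lambda>x. v (?R x) - v x)"
      by (intro continuous_intros continuous_on_compose2[OF cont contR RclU]
          continuous_on_subset[OF cont clU])
    show "0 \<le> v (?R y) - v y" if y: "y \<in> frontier ?U" for y
    proof -
      have ycl: "y \<in> closure ?U" and "y \<notin> ?U"
        using y openU by (auto simp: frontier_def interior_open)
      have "closure ?U \<subseteq> {y. \<nu> \<bullet> y \<le> t}"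
        by (rule closure_minimal[OF _ closed_halfspace_le]) (auto simp: cap_def inner_commute)
      then have "y \<bullet> \<nu> \<le> t"
        using ycl by (auto simp: inner_commute)
      then consider "y \<bullet> \<nu> = t" | "y \<bullet> \<nu> < t" by linarith
      then show ?thesis
      proof cases
        case 1
        then show ?thesis by (simp add: hyperplane_reflection_def)
      next
        case 2
        then have "y \<in> frontier \<Omega>"
          using \<open>y \<notin> ?U\<close> ycl clU \<Omega>(1) by (auto simp: frontier_def interior_open cap_def)
        then have "v y = 0"
          using v by (simp add: positive_dirichlet_solution_def)
        moreover have "0 \<le> v (?R y)"
          using positive_dirichlet_solution_nonneg[OF v] RclU ycl by blast
        ultimately show ?thesis by simp
      qed
    qed
    fix y assume y: "y \<in> ?U"
    have td: "twice_diff_at v y" "twice_diff_at v (?R y)"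
      using solution_twice_diff_at[OF v \<Omega>(1)] y UsubO RU by blast+
    note tdR = twice_diff_at_compose_affine[OF has_derivative_reflection td(2)]
    show "twice_diff_at (\<lambda>x. v (?R x) - v x) y"
      by (rule twice_diff_at_diff[OF tdR td(1)])
    assume "v (?R y) - v y < 0"
    then have "F (v y) < F (v (?R y))"
      using F v RU[OF y] by (simp add: positive_dirichlet_solution_def)
    then show "laplacian (\<lambda>x. v (?R x) - v x) y < 0"
      using y UsubO RU[OF y]
      by (simp add: laplacian_diff[OF tdR td(1)] laplacian_reflection[OF \<nu> td(2)]
          solution_laplacian[OF v] subset_iff)
  qed
  then show ?thesis by simp
qed

text \<open>A negative derivative at \<open>x\<close> would contradict the comparison with the reflection in a
  hyperplane slightly beyond \<open>x\<close>, which moves \<open>x\<close> by a small distance in the direction \<open>\<nu>\<close>.\<close>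

lemma solution_monotone_in_cap:
  fixes \<Omega> :: "'a::euclidean_space set"
  assumes \<Omega>: "open \<Omega>" "bounded \<Omega>" and \<nu>: "norm \<nu> = 1"
    and v: "positive_dirichlet_solution \<Omega> F v"
    and F: "\<And>s t. 0 < s \<Longrightarrow> s < t \<Longrightarrow> F t < F s"
    and l: "ereal l < max_cap_position \<Omega> \<nu>" and x: "x \<in> cap \<Omega> \<nu> l"
  shows "0 \<le> dir_deriv \<nu> v x"
proof (rule ccontr)
  assume neg: "\<not> ?thesis"
  obtain l' where l': "l < l'"
    "\<And>t. cap_start \<Omega> \<nu> < t \<Longrightarrow> t \<le> l' \<Longrightarrow> reflected_cap \<Omega> \<nu> t \<subseteq> \<Omega>"
    using l unfolding max_cap_position_def less_Sup_iff by auto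
  have x': "x \<in> \<Omega>" "x \<bullet> \<nu> < l"
    using x by (auto simp: cap_def)
  have "bdd_below ((\<lambda>x. x \<bullet> \<nu>) ` \<Omega>)"
  proof -
    obtain B where B: "\<And>y. y \<in> \<Omega> \<Longrightarrow> norm y \<le> B"
      using \<Omega>(2) unfolding bounded_iff by blast
    show ?thesis
    proof (rule bdd_belowI2[of _ "- B"])
      fix y assume "y \<in> \<Omega>"
      then show "- B \<le> y \<bullet> \<nu>"
        using B[of y] Cauchy_Schwarz_ineq2[of y \<nu>] \<nu> by auto
    qed
  qed
  then have start: "cap_start \<Omega> \<nu> \<le> x \<bullet> \<nu>"
    unfolding cap_start_def using x'(1) by (rule cINF_lower)
  have "v differentiable (at (x + 0 *\<^sub>R \<nu>))"
    using twice_diff_at_imp_differentiable[OF solution_twice_diff_at[OF v \<Omega>(1) x'(1)]] by simp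
  from has_real_derivative_line[OF this] neg obtain d where
    d: "d > 0" "\<And>h. 0 < h \<Longrightarrow> h < d \<Longrightarrow> v (x + h *\<^sub>R \<nu>) < v x"
    using DERIV_neg_dec_right[of "\<lambda>t. v (x + t *\<^sub>R \<nu>)" _ 0] by force
  define h where "h = min (d / 2) (l - x \<bullet> \<nu>)"
  have h: "0 < h" "h < d" "h \<le> l - x \<bullet> \<nu>"
    using d(1) x'(2) by (auto simp: h_def)
  define t where "t = x \<bullet> \<nu> + h / 2"
  have "reflected_cap \<Omega> \<nu> t \<subseteq> \<Omega>"
    using l' start h by (simp add: t_def)
  moreover have "x \<in> cap \<Omega> \<nu> t"
    using x'(1) h(1) by (simp add: cap_def t_def)
  ultimately have "v x \<le> v (hyperplane_reflection \<nu> t x)"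
    using solution_le_reflection[OF \<Omega> \<nu> v] F by blast
  then show False
    using d(2)[OF h(1,2)] by (simp add: hyperplane_reflection_def t_def)
qed

lemma solution_le_of_nonlinearity_less:
  fixes \<Omega> :: "'a::euclidean_space set"
  assumes \<Omega>: "open \<Omega>" "bounded \<Omega>"
    and v: "positive_dirichlet_solution \<Omega> F v" and u: "positive_dirichlet_solution \<Omega> G u"
    and FG: "\<And>s t. 0 < s \<Longrightarrow> s < t \<Longrightarrow> F t < G s" and x: "x \<in> \<Omega>"
  shows "v x \<le> u x"
proof -
  have "0 \<le> u x - v x"
  proof (rule comparison_principle[OF \<Omega> _ _ _ _ x])
    show "continuous_on (closure \<Omega>) (\<lambda>x. u x - v x)"
      using u v unfolding positive_dirichlet_solution_def by (intro continuous_intros) auto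
    show "0 \<le> u y - v y" if "y \<in> frontier \<Omega>" for y
      using u v that unfolding positive_dirichlet_solution_def by auto
    fix y assume y: "y \<in> \<Omega>"
    note tu = solution_twice_diff_at[OF u \<Omega>(1) y] and tv = solution_twice_diff_at[OF v \<Omega>(1) y]
    show "twice_diff_at (\<lambda>x. u x - v x) y"
      by (rule twice_diff_at_diff[OF tu tv])
    assume "u y - v y < 0"
    then have "F (v y) < G (u y)"
      using FG u y by (simp add: positive_dirichlet_solution_def)
    then show "laplacian (\<lambda>x. u x - v x) y < 0"
      by (simp add: laplacian_diff[OF tu tv] solution_laplacian[OF u y] solution_laplacian[OF v y])
  qed
  then show ?thesis by simp
qed

lemma powr_minus_strict_decreasing:
  fixes s t \<gamma> :: real
  assumes "\<gamma> > 0" "0 < s" "s < t"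
  shows "t powr (- \<gamma>) < s powr (- \<gamma>)"
  using assms by (simp add: powr_less_mono2_neg)

section \<open>The differential inequality for the derivative of the difference\<close>

text \<open>The approximants are the difference quotients of \<open>w\<close> in the direction \<open>\<nu>\<close>. With
  \<open>\<phi> = u powr (- \<gamma>) - u\<^sub>0 powr (- \<gamma>)\<close> one has \<open>- \<Delta> w = \<phi> + f(u)\<close>; the difference quotient of
  \<open>f(u)\<close> is nonnegative because \<open>u\<close> increases in the direction \<open>\<nu>\<close>, and the one of \<open>\<phi>\<close> converges
  uniformly to a function that is at least \<open>- C \<partial>w/\<partial>\<nu>\<close>.\<close>

lemma approx_supersolution_dir_deriv:
  fixes u u\<^sub>0 w :: "'a::euclidean_space \<Rightarrow> real" and f :: "real \<Rightarrow> real"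
  assumes \<gamma>: "\<gamma> > 0" and \<nu>: "norm \<nu> = 1" and r: "r > 0"
    and tdu: "\<And>x. x \<in> cball p (2 * r) \<Longrightarrow> twice_diff_at u x"
    and tdu0: "\<And>x. x \<in> cball p (2 * r) \<Longrightarrow> twice_diff_at u\<^sub>0 x"
    and lapu: "\<And>x. x \<in> cball p (2 * r) \<Longrightarrow> laplacian u x = - (u x powr (- \<gamma>) + f (u x))"
    and lapu0: "\<And>x. x \<in> cball p (2 * r) \<Longrightarrow> laplacian u\<^sub>0 x = - (u\<^sub>0 x powr (- \<gamma>))"
    and pos: "\<And>x. x \<in> cball p (2 * r) \<Longrightarrow> 0 < u\<^sub>0 x"
    and le: "\<And>x. x \<in> cball p (2 * r) \<Longrightarrow> u\<^sub>0 x \<le> u x"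
    and f: "mono_on {0..} f"
    and w: "w = (\<lambda>x. u x - u\<^sub>0 x)"
    and mono0: "\<And>x. x \<in> cball p (2 * r) \<Longrightarrow> 0 \<le> dir_deriv \<nu> u\<^sub>0 x"
    and monow: "\<And>x. x \<in> cball p (2 * r) \<Longrightarrow> 0 \<le> dir_deriv \<nu> w x"
  shows "\<exists>C\<ge>0. approx_supersolution (dir_deriv \<nu> w) C (cball p r)"
proof -
  let ?K = "cball p (2 * r)"
  note diffu = twice_diff_at_imp_differentiable[OF tdu]
  note diffu0 = twice_diff_at_imp_differentiable[OF tdu0]
  have posu: "0 < u x" if "x \<in> ?K" for x
    using pos[OF that] le[OF that] by linarith
  have tdw: "twice_diff_at w x" if "x \<in> ?K" for x
    unfolding w by (rule twice_diff_at_diff[OF tdu tdu0]) (use that in auto)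
  have Dw: "dir_deriv \<nu> w x = dir_deriv \<nu> u x - dir_deriv \<nu> u\<^sub>0 x" if "x \<in> ?K" for x
    unfolding w by (rule dir_deriv_diff[OF diffu diffu0]) (use that in auto)
  have cont: "continuous_on ?K u" "continuous_on ?K u\<^sub>0"
    using diffu diffu0 differentiable_imp_continuous_within
    by (intro continuous_at_imp_continuous_on; blast)+
  have sub: "cball p r \<subseteq> ?K"
    using r by auto
  obtain m where m: "m > 0" "\<And>x. x \<in> ?K \<Longrightarrow> m \<le> u x"
    using positive_lower_bound_on_compact[OF compact_cball cont(1) posu] by blast
  define C where "C = \<gamma> * m powr (- \<gamma> - 1)"
  define \<phi> where "\<phi> x = u x powr (- \<gamma>) - u\<^sub>0 x powr (- \<gamma>)" for x
  define \<phi>' where "\<phi>' x = - \<gamma> * u x powr (- \<gamma> - 1) * dir_deriv \<nu> u x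
      + \<gamma> * u\<^sub>0 x powr (- \<gamma> - 1) * dir_deriv \<nu> u\<^sub>0 x" for x
  have d\<phi>: "\<phi> differentiable (at x)" "dir_deriv \<nu> \<phi> x = \<phi>' x" if x: "x \<in> ?K" for x
  proof -
    have P: "((\<lambda>y. v y powr (- \<gamma>)) has_derivative
        (\<lambda>k. (- \<gamma> * v x powr (- \<gamma> - 1)) * frechet_derivative v (at x) k)) (at x)"
      if "v differentiable (at x)" "0 < v x" for v :: "'a \<Rightarrow> real"
    proof -
      have "((\<lambda>s. s powr (- \<gamma>)) has_derivative (\<lambda>k. (- \<gamma> * v x powr (- \<gamma> - 1)) * k)) (at (v x))"
        using has_real_derivative_powr[OF that(2), of "- \<gamma>"] by (simp only: has_field_derivative_def)
      from has_derivative_compose[OF that(1)[unfolded frechet_derivative_works] this]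
      show ?thesis .
    qed
    have "(\<phi> has_derivative (\<lambda>k. (- \<gamma> * u x powr (- \<gamma> - 1)) * frechet_derivative u (at x) k
        - (- \<gamma> * u\<^sub>0 x powr (- \<gamma> - 1)) * frechet_derivative u\<^sub>0 (at x) k)) (at x)"
      unfolding \<phi>_def[abs_def]
      by (intro has_derivative_diff P diffu diffu0 pos posu x)
    then show "\<phi> differentiable (at x)" "dir_deriv \<nu> \<phi> x = \<phi>' x"
      by (auto simp: differentiable_def dir_deriv_eq \<phi>'_def dir_deriv_def[of \<nu> u]
          dir_deriv_def[of \<nu> u\<^sub>0])
  qed
  have "continuous_on ?K \<phi>'"
    unfolding \<phi>'_def using pos posu
    by (intro continuous_intros cont continuous_on_dir_deriv[OF tdu] continuous_on_dir_deriv[OF tdu0])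
      force+
  then have cont\<phi>: "continuous_on ?K (dir_deriv \<nu> \<phi>)"
    using d\<phi>(2) continuous_on_cong by (metis (no_types, lifting))
  have lapw: "laplacian w x = - (\<phi> x + f (u x))" if "x \<in> ?K" for x
    using laplacian_diff[OF tdu tdu0] lapu lapu0 that unfolding w \<phi>_def by simp
  have lower: "- dir_deriv \<nu> \<phi> x \<le> C * dir_deriv \<nu> w x" if x: "x \<in> ?K" for x
  proof -
    have "u x powr (- \<gamma> - 1) \<le> m powr (- \<gamma> - 1)"
      using \<gamma> m x by (intro powr_mono2') auto
    then have "\<gamma> * u x powr (- \<gamma> - 1) * dir_deriv \<nu> w x \<le> C * dir_deriv \<nu> w x"
      unfolding C_def using \<gamma> monow[OF x] by (intro mult_right_mono mult_left_mono) auto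
    moreover have "u x powr (- \<gamma> - 1) \<le> u\<^sub>0 x powr (- \<gamma> - 1)"
      using \<gamma> pos[OF x] le[OF x] by (intro powr_mono2') auto
    then have "\<gamma> * u x powr (- \<gamma> - 1) * dir_deriv \<nu> u\<^sub>0 x \<le> \<gamma> * u\<^sub>0 x powr (- \<gamma> - 1) * dir_deriv \<nu> u\<^sub>0 x"
      using \<gamma> mono0[OF x] by (intro mult_right_mono mult_left_mono) auto
    ultimately show ?thesis
      unfolding d\<phi>(2)[OF x] \<phi>'_def Dw[OF x] by (simp add: algebra_simps)
  qed
  have "\<exists>W. \<forall>x\<in>cball p r. twice_diff_at W x \<and> \<bar>W x - dir_deriv \<nu> w x\<bar> \<le> \<epsilon> \<and>
      laplacian W x \<le> C * dir_deriv \<nu> w x + \<epsilon>" if \<epsilon>: "\<epsilon> > 0" for \<epsilon>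
  proof -
    obtain h1 where h1: "h1 > 0" "\<And>h x. 0 < h \<Longrightarrow> h < h1 \<Longrightarrow> x \<in> cball p r \<Longrightarrow>
        \<bar>(w (x + h *\<^sub>R \<nu>) - w x) / h - dir_deriv \<nu> w x\<bar> \<le> \<epsilon>"
      using diff_quotient_uniform[OF twice_diff_at_imp_differentiable[OF tdw]
          continuous_on_dir_deriv[OF tdw] \<nu> r \<epsilon>] by blast
    obtain h2 where h2: "h2 > 0" "\<And>h x. 0 < h \<Longrightarrow> h < h2 \<Longrightarrow> x \<in> cball p r \<Longrightarrow>
        \<bar>(\<phi> (x + h *\<^sub>R \<nu>) - \<phi> x) / h - dir_deriv \<nu> \<phi> x\<bar> \<le> \<epsilon>"
      using diff_quotient_uniform[OF d\<phi>(1) cont\<phi> \<nu> r \<epsilon>] by blast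
    define h where "h = min r (min h1 h2) / 2"
    have h: "0 < h" "h < h1" "h < h2" "h < r"
      using r h1(1) h2(1) by (auto simp: h_def)
    define W where "W x = (1 / h) * (w (x + h *\<^sub>R \<nu>) - w x)" for x
    have "twice_diff_at W x \<and> \<bar>W x - dir_deriv \<nu> w x\<bar> \<le> \<epsilon> \<and>
        laplacian W x \<le> C * dir_deriv \<nu> w x + \<epsilon>" if x: "x \<in> cball p r" for x
    proof (intro conjI)
      have xK: "x \<in> ?K"
        using x sub by blast
      have seg: "x + t *\<^sub>R \<nu> \<in> ?K" if "0 \<le> t" "t \<le> h" for t
        using dist_triangle[of p "x + t *\<^sub>R \<nu>" x] x h(4) that \<nu> by (simp add: dist_norm)
      have xh: "x + h *\<^sub>R \<nu> \<in> ?K"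
        using seg h(1) by simp
      note tdT = twice_diff_at_compose_affine[OF has_derivative_translation tdw[OF xh]]
      note td = twice_diff_at_diff[OF tdT tdw[OF xK]]
      show "twice_diff_at W x"
        unfolding W_def[abs_def] by (rule twice_diff_at_cmult[OF td])
      show "\<bar>W x - dir_deriv \<nu> w x\<bar> \<le> \<epsilon>"
        using h1(2)[OF h(1,2) x] by (simp add: W_def)
      have "laplacian W x = (1 / h) * (laplacian w (x + h *\<^sub>R \<nu>) - laplacian w x)"
        unfolding W_def[abs_def] laplacian_cmult[OF td] laplacian_diff[OF tdT tdw[OF xK]]
          laplacian_compose_affine[OF has_derivative_translation tdw[OF xh]]
        by (simp add: laplacian_def)
      also have "\<dots> = - ((\<phi> (x + h *\<^sub>R \<nu>) - \<phi> x) / h) - (f (u (x + h *\<^sub>R \<nu>)) - f (u x)) / h"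
        unfolding lapw[OF xh] lapw[OF xK] by (simp add: diff_divide_distrib add_divide_distrib)
      also have "\<dots> \<le> - ((\<phi> (x + h *\<^sub>R \<nu>) - \<phi> x) / h)"
      proof -
        have "u (x + 0 *\<^sub>R \<nu>) \<le> u (x + h *\<^sub>R \<nu>)"
        proof (rule DERIV_nonneg_imp_nondecreasing[of 0 h "\<lambda>t. u (x + t *\<^sub>R \<nu>)"])
          fix t assume "0 \<le> t" "t \<le> h"
          then have tK: "x + t *\<^sub>R \<nu> \<in> ?K"
            by (rule seg)
          have "0 \<le> dir_deriv \<nu> u (x + t *\<^sub>R \<nu>)"
            using Dw[OF tK] monow[OF tK] mono0[OF tK] by simp
          then show "\<exists>y. ((\<lambda>t. u (x + t *\<^sub>R \<nu>)) has_real_derivative y) (at t) \<and> 0 \<le> y"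
            using has_real_derivative_line[OF diffu[OF tK]] by blast
        qed (use h in simp)
        then have "f (u x) \<le> f (u (x + h *\<^sub>R \<nu>))"
          using posu[OF xK] posu[OF xh] by (intro mono_onD[OF f]) auto
        then show ?thesis
          using h(1) by simp
      qed
      also have "\<dots> \<le> C * dir_deriv \<nu> w x + \<epsilon>"
        using h2(2)[OF h(1,3) x] lower[OF xK] by linarith
      finally show "laplacian W x \<le> C * dir_deriv \<nu> w x + \<epsilon>" .
    qed
    then show ?thesis by blast
  qed
  then have "approx_supersolution (dir_deriv \<nu> w) C (cball p r)"
    by (simp add: approx_supersolution_def)
  moreover have "C \<ge> 0"
    using \<gamma> by (simp add: C_def)
  ultimately show ?thesis by blast
qed

theorem proposition4p3:
  fixes \<Omega> \<Omega>' :: "(real ^ 'n) set"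
    and \<nu> :: "real ^ 'n"
    and u u\<^sub>0 w :: "real ^ 'n \<Rightarrow> real"
    and f :: "real \<Rightarrow> real"
    and \<gamma> l :: real
  assumes "\<gamma> > 0"
    and "bounded_smooth_domain \<Omega>"
    and "locally_lipschitz_on {0..} f"
    and "mono_on {0..} f"
    and "\<And>s. s > 0 \<Longrightarrow> f s > 0"
    and "f 0 \<ge> 0"
    and "norm \<nu> = 1"
    and "cap_start \<Omega> \<nu> < l"
    and "ereal l < max_cap_position \<Omega> \<nu>"
    and "open \<Omega>'" and "connected \<Omega>'" and "\<Omega>' \<subseteq> cap \<Omega> \<nu> l"
    and "positive_dirichlet_solution \<Omega> (\<lambda>s. s powr (- \<gamma>)) u\<^sub>0"
    and "positive_dirichlet_solution \<Omega> (\<lambda>s. 1 / s powr \<gamma> + f s) u"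
    and "w = (\<lambda>x. u x - u\<^sub>0 x)"
    and "\<forall>x\<in>\<Omega>'. dir_deriv \<nu> w x \<ge> 0"
  shows "(\<forall>x\<in>\<Omega>'. dir_deriv \<nu> w x > 0) \<or> (\<forall>x\<in>\<Omega>'. dir_deriv \<nu> w x = 0)"
proof (rule strong_maximum_principle[OF \<open>open \<Omega>'\<close> \<open>connected \<Omega>'\<close>])
  have \<Omega>: "open \<Omega>" "bounded \<Omega>"
    using \<open>bounded_smooth_domain \<Omega>\<close> by (auto simp: bounded_smooth_domain_def)
  have sub: "\<Omega>' \<subseteq> \<Omega>"
    using \<open>\<Omega>' \<subseteq> cap \<Omega> \<nu> l\<close> by (auto simp: cap_def)
  note u = \<open>positive_dirichlet_solution \<Omega> (\<lambda>s. 1 / s powr \<gamma> + f s) u\<close>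
    and u0 = \<open>positive_dirichlet_solution \<Omega> (\<lambda>s. s powr (- \<gamma>)) u\<^sub>0\<close>
  note tdu = solution_twice_diff_at[OF u \<Omega>(1)] and tdu0 = solution_twice_diff_at[OF u0 \<Omega>(1)]
  have le: "u\<^sub>0 x \<le> u x" if "x \<in> \<Omega>" for x
  proof (rule solution_le_of_nonlinearity_less[OF \<Omega> u0 u _ that])
    fix s t :: real assume "0 < s" "s < t"
    then have "t powr (- \<gamma>) < s powr (- \<gamma>)"
      by (rule powr_minus_strict_decreasing[OF \<open>\<gamma> > 0\<close>])
    then show "t powr (- \<gamma>) < 1 / s powr \<gamma> + f s"
      using \<open>\<And>s. s > 0 \<Longrightarrow> f s > 0\<close>[OF \<open>0 < s\<close>] by (simp add: powr_minus_divide)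
  qed
  have mono0: "0 \<le> dir_deriv \<nu> u\<^sub>0 x" if "x \<in> \<Omega>'" for x
  proof (rule solution_monotone_in_cap[OF \<Omega> \<open>norm \<nu> = 1\<close> u0])
    show "t powr (- \<gamma>) < s powr (- \<gamma>)" if "0 < s" "s < t" for s t :: real
      using that by (rule powr_minus_strict_decreasing[OF \<open>\<gamma> > 0\<close>])
    show "ereal l < max_cap_position \<Omega> \<nu>"
      by fact
    show "x \<in> cap \<Omega> \<nu> l"
      using \<open>\<Omega>' \<subseteq> cap \<Omega> \<nu> l\<close> that by blast
  qed
  show "continuous_on \<Omega>' (dir_deriv \<nu> w)"
    using twice_diff_at_diff[OF tdu tdu0] sub unfolding \<open>w = (\<lambda>x. u x - u\<^sub>0 x)\<close>
    by (intro continuous_on_dir_deriv) blast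
  show "0 \<le> dir_deriv \<nu> w x" if "x \<in> \<Omega>'" for x
    using \<open>\<forall>x\<in>\<Omega>'. dir_deriv \<nu> w x \<ge> 0\<close> that by blast
  show "\<exists>r>0. \<exists>C\<ge>0. approx_supersolution (dir_deriv \<nu> w) C (cball p r)" if p: "p \<in> \<Omega>'" for p
  proof -
    obtain r' where "r' > 0" "cball p r' \<subseteq> \<Omega>'"
      using \<open>open \<Omega>'\<close> p open_contains_cball by blast
    then obtain r where r: "r > 0" and K: "cball p (2 * r) \<subseteq> \<Omega>'"
      by (metis half_gt_zero mult.commute nonzero_divide_eq_eq zero_neq_numeral)
    have K': "x \<in> \<Omega>" if "x \<in> cball p (2 * r)" for x
      using that K sub by blast
    have "\<exists>C\<ge>0. approx_supersolution (dir_deriv \<nu> w) C (cball p r)"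
    proof (rule approx_supersolution_dir_deriv[OF \<open>\<gamma> > 0\<close> \<open>norm \<nu> = 1\<close> r _ _ _ _ _ _
          \<open>mono_on {0..} f\<close> \<open>w = (\<lambda>x. u x - u\<^sub>0 x)\<close>])
      fix x assume x: "x \<in> cball p (2 * r)"
      note x\<Omega> = K'[OF x]
      have x\<Omega>': "x \<in> \<Omega>'"
        using K x by blast
      show "twice_diff_at u x" "twice_diff_at u\<^sub>0 x" "u\<^sub>0 x \<le> u x" "0 \<le> dir_deriv \<nu> u\<^sub>0 x"
        using tdu[OF x\<Omega>] tdu0[OF x\<Omega>] le[OF x\<Omega>] mono0[OF x\<Omega>'] by auto
      show "laplacian u x = - (u x powr (- \<gamma>) + f (u x))"
        using solution_laplacian[OF u x\<Omega>] by (simp add: powr_minus_divide)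
      show "laplacian u\<^sub>0 x = - (u\<^sub>0 x powr (- \<gamma>))"
        by (rule solution_laplacian[OF u0 x\<Omega>])
      show "0 < u\<^sub>0 x"
        using u0 x\<Omega> by (simp add: positive_dirichlet_solution_def)
      show "0 \<le> dir_deriv \<nu> w x"
        using \<open>\<forall>x\<in>\<Omega>'. dir_deriv \<nu> w x \<ge> 0\<close> x\<Omega>' by blast
    qed
    then show ?thesis
      using r by blast
  qed
qed

end
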